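(* Let $X$ be a complete metric space and let $U:\{(t,s)\in\mathbb{R}^2:t\ge s\}\times X\to X$ be a continuous process which possesses a pullback attractor $\mathcal{A}=\{\mathcal{A}(t)\}_{t\in\mathbb{R}}$. Assume that $U$ is forward asymptotically compact. (i) If for any bounded set $B\subset X$ and any $t_0\in\mathbb{R}$ we have $\omega_f(B,t_0)\subset\omega_0(\mathcal{A})$, then $\mathcal{A}$ is a forward attractor and $\omega(\mathcal{A})=\omega_0(\mathcal{A})$. (ii) If $\mathcal{A}$ is a forward attractor, then $\omega_f(B,t_0)\subset\omega(\mathcal{A})$ for any $t_0\in\mathbb{R}$ and any bounded set $B\subset X$.
   Context: Let $\rho$ be the metric of $X$. For $A,B\subset X$, $dist(A,B)=\sup_{y\in A}\inf_{x\in B}\rho(y,x)$ is the Hausdorff semidistance, and $dist(y,B)=dist(\{y\},B)$. A continuous process satisfies: $U(s,s,x)=x$; $U(t,s,x)=U(t,\tau,U(\tau,s,x))$ for $s\le\tau\le t$; and $(t,s,x)\mapsto U(t,s,x)$ is continuous. Write $U(t,s,B)=\{U(t,s,x):x\in B\}$. A family $\{K(t)\}_{t\in\mathbb{R}}$ of subsets of $X$ is invariant if $K(t)=U(t,s,K(s))$ for all $t\ge s$; it is called compact (closed) if each $K(t)$ is compact (closed). A family of non-empty sets $\mathcal{A}=\{\mathcal{A}(t)\}$ is pullback attracting if for every bounded $B\subset X$ and every fixed $t$, $dist(U(t,t_0,B),\mathcal{A}(t))\to0$ as $t_0\to-\infty$; it is forward attracting if for every bounded $B\subset X$ and every fixed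 $t_0$, $dist(U(t,t_0,B),\mathcal{A}(t))\to0$ as $t\to+\infty$. A pullback attractor is a family of non-empty compact invariant sets that is the minimal pullback attracting family of closed sets (i.e. it is pullback attracting, and if $\mathcal{C}=\{\mathcal{C}(t)\}$ is a closed pullback attracting family then $\mathcal{A}(t)\subset\mathcal{C}(t)$ for all $t$). A forward attractor is a family of non-empty compact invariant sets that is forward attracting. $U$ is forward asymptotically compact if for every $t_0\in\mathbb{R}$, every bounded $B\subset X$ and all $t_n\to+\infty$, every sequence $y_n\in U(t_n,t_0,B)$ has a converging subsequence. Limit sets: $\omega_f(B,t_0)=\{y:y=\lim_{n\to\infty}y_n,\ y_n\in U(t_n,t_0,B),\ t_n\to+\infty\}$. For a family $\mathcal{K}=\{K(t)\}$: $\omega(\mathcal{K})=\{y:y=\lim_{n\to\infty}y_n,\ y_n\in K(t_n),\ t_n\to+\infty\}$ and $\omega_0(\mathcal{K})=\{y\in X:\lim_{t\to+\infty}dist(y,K(t))=0\}$. *)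

theory Defs
  imports "HOL-Analysis.Analysis"
begin

text \<open>
  The Hausdorff semidistance takes values in the extended nonnegative reals: the supremum may be
  infinite for unbounded sets, and \<open>SUP\<close>/\<open>INF\<close> over \<open>{}\<close> are \<open>0\<close> and \<open>\<infinity>\<close> there.
\<close>

definition semidist :: "'a::metric_space set \<Rightarrow> 'a set \<Rightarrow> ennreal" where
  "semidist A B = (SUP y\<in>A. INF x\<in>B. ennreal (dist y x))"

text \<open>
  A process is a total function \<open>U t s x\<close> of which only the values with \<open>s \<le> t\<close> are meaningful;
  the others never matter below (in limits, \<open>s \<le> t\<close> holds eventually).
\<close>

definition continuous_process :: "(real \<Rightarrow> real \<Rightarrow> 'a::metric_space \<Rightarrow> 'a) \<Rightarrow> bool" where
  "continuous_process U \<longleftrightarrow>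
     (\<forall>s x. U s s x = x) \<and>
     (\<forall>s \<tau> t x. s \<le> \<tau> \<longrightarrow> \<tau> \<le> t \<longrightarrow> U t s x = U t \<tau> (U \<tau> s x)) \<and>
     continuous_on {(t, s, x). s \<le> t} (\<lambda>(t, s, x). U t s x)"

definition invariant_family ::
    "(real \<Rightarrow> real \<Rightarrow> 'a \<Rightarrow> 'a) \<Rightarrow> (real \<Rightarrow> 'a set) \<Rightarrow> bool" where
  "invariant_family U K \<longleftrightarrow> (\<forall>s t. s \<le> t \<longrightarrow> K t = U t s ` K s)"

definition pullback_attracting ::
    "(real \<Rightarrow> real \<Rightarrow> 'a::metric_space \<Rightarrow> 'a) \<Rightarrow> (real \<Rightarrow> 'a set) \<Rightarrow> bool" where
  "pullback_attracting U A \<longleftrightarrow>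
     (\<forall>t. A t \<noteq> {}) \<and>
     (\<forall>B t. bounded B \<longrightarrow> ((\<lambda>t\<^sub>0. semidist (U t t\<^sub>0 ` B) (A t)) \<longlongrightarrow> 0) at_bot)"

definition forward_attracting ::
    "(real \<Rightarrow> real \<Rightarrow> 'a::metric_space \<Rightarrow> 'a) \<Rightarrow> (real \<Rightarrow> 'a set) \<Rightarrow> bool" where
  "forward_attracting U A \<longleftrightarrow>
     (\<forall>t. A t \<noteq> {}) \<and>
     (\<forall>B t\<^sub>0. bounded B \<longrightarrow> ((\<lambda>t. semidist (U t t\<^sub>0 ` B) (A t)) \<longlongrightarrow> 0) at_top)"

definition pullback_attractor ::
    "(real \<Rightarrow> real \<Rightarrow> 'a::metric_space \<Rightarrow> 'a) \<Rightarrow> (real \<Rightarrow> 'a set) \<Rightarrow> bool" where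
  "pullback_attractor U A \<longleftrightarrow>
     (\<forall>t. A t \<noteq> {} \<and> compact (A t)) \<and> invariant_family U A \<and> pullback_attracting U A \<and>
     (\<forall>C. (\<forall>t. closed (C t)) \<longrightarrow> pullback_attracting U C \<longrightarrow> (\<forall>t. A t \<subseteq> C t))"

definition forward_attractor ::
    "(real \<Rightarrow> real \<Rightarrow> 'a::metric_space \<Rightarrow> 'a) \<Rightarrow> (real \<Rightarrow> 'a set) \<Rightarrow> bool" where
  "forward_attractor U A \<longleftrightarrow>
     (\<forall>t. A t \<noteq> {} \<and> compact (A t)) \<and> invariant_family U A \<and> forward_attracting U A"

definition forward_asymptotically_compact ::
    "(real \<Rightarrow> real \<Rightarrow> 'a::metric_space \<Rightarrow> 'a) \<Rightarrow> bool" where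
  "forward_asymptotically_compact U \<longleftrightarrow>
     (\<forall>t\<^sub>0 B t y. bounded B \<longrightarrow> filterlim t at_top sequentially \<longrightarrow>
        (\<forall>n::nat. t\<^sub>0 \<le> t n \<and> y n \<in> U (t n) t\<^sub>0 ` B) \<longrightarrow>
        (\<exists>r l. strict_mono (r :: nat \<Rightarrow> nat) \<and> (y \<circ> r) \<longlonglongrightarrow> l))"

definition omega_f ::
    "(real \<Rightarrow> real \<Rightarrow> 'a::metric_space \<Rightarrow> 'a) \<Rightarrow> 'a set \<Rightarrow> real \<Rightarrow> 'a set" where
  "omega_f U B t\<^sub>0 =
     {z. \<exists>t y. filterlim t at_top sequentially \<and>
               (\<forall>n::nat. t\<^sub>0 \<le> t n \<and> y n \<in> U (t n) t\<^sub>0 ` B) \<and> y \<longlonglongrightarrow> z}"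

definition omega :: "(real \<Rightarrow> 'a::metric_space set) \<Rightarrow> 'a set" where
  "omega K =
     {z. \<exists>t y. filterlim t at_top sequentially \<and> (\<forall>n::nat. y n \<in> K (t n)) \<and> y \<longlonglongrightarrow> z}"

definition omega_0 :: "(real \<Rightarrow> 'a::metric_space set) \<Rightarrow> 'a set" where
  "omega_0 K = {y. ((\<lambda>t. semidist {y} (K t)) \<longlongrightarrow> 0) at_top}"

end

theory Submission
  imports Defs
begin

text \<open>
  Forward asymptotic compactness turns a failure of forward attraction into a convergent sequence
  of trajectory points staying away from the attractor at the corresponding times; its limit lies in
  the forward limit set, hence is approached by the attractor as time grows, a contradiction.
  By invariance, every sequence in the attractor along times tending to infinity is eventually a
  sequence of trajectory points issuing from one bounded section, which gives the inclusion of
  \<open>omega A\<close> in \<open>omega_0 A\<close>.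
\<close>

text \<open>The type is kept general so that the same squeeze serves real distances and
  \<open>ennreal\<close> semidistances.\<close>

lemma tendsto_0_squeeze:
  fixes f g :: "'a \<Rightarrow> 'b::{linorder_topology, zero}"
  assumes "(g \<longlongrightarrow> 0) F" "\<And>x. 0 \<le> f x" "\<And>x. f x \<le> g x"
  shows "(f \<longlongrightarrow> 0) F"
  using tendsto_sandwich[of "\<lambda>_. 0" f F g 0] assms by simp

lemma infdist_almost_attained:
  assumes "A \<noteq> {}" "0 < e"
  obtains x where "x \<in> A" "dist y x < infdist y A + e"
  using cInf_lessD[of "dist y ` A" "infdist y A + e"] assms by (auto simp: infdist_def)

text \<open>This bridge lets the limits be computed with the real-valued \<open>infdist\<close>.
  Nonemptiness matters: for the empty set the infimum is \<infinity>, whereas \<open>infdist\<close>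
  is 0 by convention.\<close>

lemma INF_ennreal_dist:
  assumes "A \<noteq> {}"
  shows "(INF x\<in>A. ennreal (dist y x)) = ennreal (infdist y A)"
proof (rule antisym)
  show "(INF x\<in>A. ennreal (dist y x)) \<le> ennreal (infdist y A)"
  proof (rule ennreal_le_epsilon)
    fix e :: real
    assume "0 < e"
    then obtain x where "x \<in> A" "dist y x < infdist y A + e"
      using infdist_almost_attained assms by blast
    then have "(INF x\<in>A. ennreal (dist y x)) \<le> ennreal (infdist y A + e)"
      by (meson INF_lower2 ennreal_leI less_imp_le)
    then show "(INF x\<in>A. ennreal (dist y x)) \<le> ennreal (infdist y A) + ennreal e"
      using \<open>0 < e\<close> by (simp add: infdist_nonneg)
  qed
  show "ennreal (infdist y A) \<le> (INF x\<in>A. ennreal (dist y x))"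
    by (intro INF_greatest ennreal_leI infdist_le)
qed

lemma semidist_singleton: "A \<noteq> {} \<Longrightarrow> semidist {y} A = ennreal (infdist y A)"
  by (simp add: semidist_def INF_ennreal_dist)

lemma infdist_le_semidist:
  "y \<in> B \<Longrightarrow> A \<noteq> {} \<Longrightarrow> ennreal (infdist y A) \<le> semidist B A"
  unfolding semidist_def by (subst INF_ennreal_dist[symmetric]) (auto intro: SUP_upper)

lemma semidist_greaterE:
  assumes "e < semidist B A" "A \<noteq> {}"
  obtains y where "y \<in> B" "e < ennreal (infdist y A)"
  using assms by (auto simp: semidist_def INF_ennreal_dist less_SUP_iff)

lemma omega_0_iff:
  assumes "\<And>t. A t \<noteq> {}"
  shows "z \<in> omega_0 A \<longleftrightarrow> ((\<lambda>t. infdist z (A t)) \<longlongrightarrow> 0) at_top"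
  using tendsto_ennreal_iff[of "\<lambda>t. infdist z (A t)" at_top 0]
  by (simp add: omega_0_def semidist_singleton assms infdist_nonneg)

text \<open>The infimum defining \<open>infdist\<close> need not be attained, so pick
  \<open>x n\<close> in \<open>A (t n)\<close> that realises it up to an error 1/(n+1). Then
  \<open>dist (y n) (x n)\<close> tends to 0, and \<open>x\<close> inherits the limit of
  \<open>y\<close>.\<close>

lemma omega_if_infdist_tendsto_0:
  assumes A: "\<And>t. A t \<noteq> {}"
    and t: "filterlim t at_top sequentially"
    and y: "y \<longlonglongrightarrow> z"
    and d: "(\<lambda>n. infdist (y n) (A (t n))) \<longlonglongrightarrow> 0"
  shows "z \<in> omega A"
proof -
  have "\<exists>x. x \<in> A (t n) \<and> dist (y n) x < infdist (y n) (A (t n)) + inverse (real (Suc n))" for n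
    using A[of "t n"] by (rule infdist_almost_attained[where e = "inverse (real (Suc n))"]) auto
  then obtain x where x: "x n \<in> A (t n)"
      "dist (y n) (x n) < infdist (y n) (A (t n)) + inverse (real (Suc n))" for n
    by metis
  have "(\<lambda>n. infdist (y n) (A (t n)) + inverse (real (Suc n))) \<longlonglongrightarrow> 0"
    using tendsto_add[OF d LIMSEQ_inverse_real_of_nat] by simp
  then have "(\<lambda>n. dist (y n) (x n)) \<longlonglongrightarrow> 0"
    by (rule tendsto_0_squeeze) (use x(2) less_imp_le in auto)
  then have "(\<lambda>n. dist (y n) (x n) + dist (y n) z) \<longlonglongrightarrow> 0"
    using tendsto_add[OF _ y[unfolded tendsto_dist_iff[of y]]] by fastforce
  then have "(\<lambda>n. dist (x n) z) \<longlonglongrightarrow> 0"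
    by (rule tendsto_0_squeeze) (auto simp: dist_triangle3)
  then have "x \<longlonglongrightarrow> z"
    using tendsto_dist_iff by blast
  then show ?thesis
    using t x(1) by (auto simp: omega_def)
qed

lemma omega_0_subset_omega:
  assumes "\<And>t. A t \<noteq> {}"
  shows "omega_0 A \<subseteq> omega A"
proof
  fix z
  assume "z \<in> omega_0 A"
  then have "((\<lambda>t. infdist z (A t)) \<longlongrightarrow> 0) at_top"
    using omega_0_iff assms by blast
  then have "(\<lambda>n. infdist z (A (real n))) \<longlonglongrightarrow> 0"
    using filterlim_real_sequentially by (rule filterlim_compose)
  then show "z \<in> omega A"
    \<comment> \<open>Here the approximated sequence is constantly \<open>z\<close>, taken at the
      times 0, 1, 2, ...\<close>
    by (rule omega_if_infdist_tendsto_0[OF assms filterlim_real_sequentially tendsto_const])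
qed

text \<open>By invariance, points of \<open>A\<close> at times after \<open>s\<close> are endpoints
  of trajectories that start in the single section \<open>A s\<close>.\<close>

lemma omega_subset_omega_f:
  assumes "invariant_family U A"
  shows "omega A \<subseteq> omega_f U (A s) s"
proof
  fix z
  assume "z \<in> omega A"
  then obtain t y where t: "filterlim t at_top sequentially"
    and y: "\<And>n. y n \<in> A (t n)" and lim: "y \<longlonglongrightarrow> z"
    by (auto simp: omega_def)
  obtain N where N: "\<And>n. N \<le> n \<Longrightarrow> s \<le> t n"
    using t by (auto simp: filterlim_at_top eventually_sequentially)
  \<comment> \<open>Finitely many times may precede \<open>s\<close>, where invariance says nothing
    and which \<open>omega_f\<close> does not admit; shifting the index by \<open>N\<close> drops
    them.\<close>
  have "filterlim (\<lambda>n. t (n + N)) at_top sequentially"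
    using t by (rule filterlim_compose) (rule filterlim_add_const_nat_at_top)
  moreover have "s \<le> t (n + N)" for n
    by (simp add: N)
  moreover from this have "y (n + N) \<in> U (t (n + N)) s ` A s" for n
    using y assms unfolding invariant_family_def by blast
  moreover have "(\<lambda>n. y (n + N)) \<longlonglongrightarrow> z"
    using lim by (rule LIMSEQ_ignore_initial_segment)
  ultimately show "z \<in> omega_f U (A s) s"
    unfolding omega_f_def
    by (intro CollectI exI[of _ "\<lambda>n. t (n + N)"] exI[of _ "\<lambda>n. y (n + N)"]) simp
qed

lemma forward_attracting_if_omega_f_subset:
  assumes compact: "forward_asymptotically_compact U"
    and A: "\<And>t. A t \<noteq> {}"
    and sub: "\<And>B s. bounded B \<Longrightarrow> omega_f U B s \<subseteq> omega_0 A"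
  shows "forward_attracting U A"
proof -
  have "((\<lambda>t. semidist (U t s ` B) (A t)) \<longlongrightarrow> 0) at_top" if B: "bounded B" for B s
  proof (rule ccontr)
    assume "\<not> ?thesis"
    then obtain e where e: "0 < e"
      and "\<not> (\<forall>\<^sub>F t in at_top. semidist (U t s ` B) (A t) < e)"
      by (auto simp: order_tendsto_iff)
    then have "\<exists>t\<ge>b. e \<le> semidist (U t s ` B) (A t)" for b
      by (auto simp: eventually_at_top_linorder not_less)
    \<comment> \<open>The bound \<open>max s (real n)\<close> keeps the times after \<open>s\<close>
      and also drives them to infinity.\<close>
    then have "\<exists>t. max s (real n) \<le> t \<and> e \<le> semidist (U t s ` B) (A t)" for n :: nat
      by blast
    then obtain t where t: "\<And>n. max s (real n) \<le> t n"
      and far: "\<And>n. e \<le> semidist (U (t n) s ` B) (A (t n))"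
      by metis
    \<comment> \<open>The supremum in \<open>semidist\<close> is at least \<open>e\<close> but
      possibly not attained; some point strictly exceeds any smaller level \<open>d\<close>.\<close>
    obtain d where d: "0 < d" "d < e"
      using e dense by blast
    have "\<exists>y. y \<in> U (t n) s ` B \<and> d < ennreal (infdist y (A (t n)))" for n
      using semidist_greaterE[OF less_le_trans[OF d(2) far] A] by metis
    then obtain y where y: "y n \<in> U (t n) s ` B"
      and y_far: "d < ennreal (infdist (y n) (A (t n)))" for n
      by metis
    have t_top: "filterlim t at_top sequentially"
      using filterlim_real_sequentially by (rule filterlim_at_top_mono) (use t in auto)
    then obtain r l where r: "strict_mono (r :: nat \<Rightarrow> nat)" and lim: "(y \<circ> r) \<longlonglongrightarrow> l"
      using compact B t y unfolding forward_asymptotically_compact_def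
      by (metis max.bounded_iff)
    have r_top: "filterlim (t \<circ> r) at_top sequentially"
      using filterlim_compose[OF t_top filterlim_subseq[OF r]] by (simp add: o_def)
    have "l \<in> omega_f U B s"
      unfolding omega_f_def
      by (intro CollectI exI[of _ "t \<circ> r"] exI[of _ "y \<circ> r"]) (use r_top lim t y in auto)
    then have "((\<lambda>t. infdist l (A t)) \<longlongrightarrow> 0) at_top"
      using sub[OF B] omega_0_iff[of A l, OF A] by blast
    then have "(\<lambda>n. infdist l (A (t (r n)))) \<longlonglongrightarrow> 0"
      using filterlim_compose[OF _ r_top] by (simp add: o_def)
    moreover have "(\<lambda>n. dist (y (r n)) l) \<longlonglongrightarrow> 0"
      using lim tendsto_dist_iff by (force simp: o_def)
    \<comment> \<open>This sum bounds the distance from \<open>y (r n)\<close> to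
      \<open>A (t (r n))\<close>, because \<open>infdist\<close> is 1-Lipschitz in its
      point.\<close>
    ultimately have "(\<lambda>n. infdist l (A (t (r n))) + dist (y (r n)) l) \<longlonglongrightarrow> 0"
      using tendsto_add by fastforce
    then have "(\<lambda>n. infdist (y (r n)) (A (t (r n)))) \<longlonglongrightarrow> 0"
      by (rule tendsto_0_squeeze) (auto simp: infdist_nonneg infdist_triangle)
    then have "(\<lambda>n. ennreal (infdist (y (r n)) (A (t (r n))))) \<longlonglongrightarrow> 0"
      by (simp add: ennreal_tendsto_0_iff infdist_nonneg)
    then have "\<forall>\<^sub>F n in sequentially. ennreal (infdist (y (r n)) (A (t (r n)))) < d"
      using d(1) order_tendstoD(2) by blast
    then show False
      using y_far by (auto simp: eventually_sequentially dest: less_asym)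
  qed
  then show ?thesis
    by (simp add: forward_attracting_def A)
qed

text \<open>The distance from \<open>y n\<close> to \<open>A (t n)\<close> is at most the
  semidistance of the whole image of \<open>B\<close>, which tends to 0; hence the limit of
  \<open>y\<close> is also a limit of nearby points of the family.\<close>

lemma omega_f_subset_omega:
  assumes att: "forward_attracting U A" and B: "bounded B"
  shows "omega_f U B s \<subseteq> omega A"
proof
  fix z
  assume "z \<in> omega_f U B s"
  then obtain t y where t: "filterlim t at_top sequentially"
    and y: "\<And>n. y n \<in> U (t n) s ` B" and lim: "y \<longlonglongrightarrow> z"
    by (auto simp: omega_f_def)
  have A: "A t \<noteq> {}" for t
    using att by (simp add: forward_attracting_def)
  have "((\<lambda>t. semidist (U t s ` B) (A t)) \<longlongrightarrow> 0) at_top"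
    using att B by (simp add: forward_attracting_def)
  then have "(\<lambda>n. semidist (U (t n) s ` B) (A (t n))) \<longlonglongrightarrow> 0"
    using t by (rule filterlim_compose)
  then have "(\<lambda>n. ennreal (infdist (y n) (A (t n)))) \<longlonglongrightarrow> 0"
    by (rule tendsto_0_squeeze) (simp_all add: infdist_le_semidist[OF y A])
  then show "z \<in> omega A"
    by (intro omega_if_infdist_tendsto_0[OF A t lim]) (simp add: ennreal_tendsto_0_iff infdist_nonneg)
qed

theorem theorem7:
  fixes U :: "real \<Rightarrow> real \<Rightarrow> 'a::complete_space \<Rightarrow> 'a"
    and A :: "real \<Rightarrow> 'a set"
  assumes "continuous_process U"
    and "pullback_attractor U A"
    and "forward_asymptotically_compact U"
  shows "((\<forall>B t\<^sub>0. bounded B \<longrightarrow> omega_f U B t\<^sub>0 \<subseteq> omega_0 A) \<longrightarrow>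
            forward_attractor U A \<and> omega A = omega_0 A) \<and>
         (forward_attractor U A \<longrightarrow>
            (\<forall>B t\<^sub>0. bounded B \<longrightarrow> omega_f U B t\<^sub>0 \<subseteq> omega A))"
proof -
  have A: "A t \<noteq> {}" "bounded (A t)" for t
    using assms(2) by (auto simp: pullback_attractor_def compact_imp_bounded)
  have inv: "invariant_family U A"
    using assms(2) by (simp add: pullback_attractor_def)
  have "forward_attractor U A \<and> omega A = omega_0 A"
    if sub: "\<forall>B t\<^sub>0. bounded B \<longrightarrow> omega_f U B t\<^sub>0 \<subseteq> omega_0 A"
  proof
    show "forward_attractor U A"
      using forward_attracting_if_omega_f_subset[of U A, OF assms(3) A(1)] sub assms(2)
      by (auto simp: forward_attractor_def pullback_attractor_def)
    \<comment> \<open>The section \<open>A 0\<close> is compact, hence bounded, so the hypothesis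
      applies to it: \<open>omega A\<close> \<subseteq> \<open>omega_f U (A 0) 0\<close> \<subseteq>
      \<open>omega_0 A\<close> \<subseteq> \<open>omega A\<close>.\<close>
    show "omega A = omega_0 A"
      using omega_0_subset_omega[of A, OF A(1)] omega_subset_omega_f[OF inv, of 0]
        sub A(2)[of 0] by blast
  qed
  then show ?thesis
    unfolding forward_attractor_def using omega_f_subset_omega[of U A] by blast
qed

end
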